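(* Let $G$ be a group with identity $e$ and $|G|=n$, let $S,T\subseteq G\setminus\{e\}$ be disjoint, and let $V=(G\setminus\{e\})\setminus(S\cup T)$. Suppose $S=S^{-1}$ and $T^{-1}=V$. If $(S,T)$ is a signature pair of sets for an $(n,k(\mu))$-cube root equiangular frame, then: (a) for all $g\in S$, $\;N_{(S,T)}^g+N_{(T,S)}^g+N_{(T,T)}^g=\frac{n-2-\mu}{3}$; (b) for all $h\in T$, $\;N_{(V,V)}^h+N_{(S,T)}^h+N_{(S,V)}^h=\frac{\mu+n-1}{3}$; (c) for all $\tilde h\in V$, $\;N_{(T,T)}^{\tilde h}+N_{(S,T)}^{\tilde h}+N_{(S,V)}^{\tilde h}=\frac{\mu+n-1}{3}$.
   Context: For subsets $A,B\subseteq G$ and $g\in G$, $N_{(A,B)}^g=\#\{(g_1,g_2)\in A\times B: g_1g_2=g\}$, and $A^{-1}=\{a^{-1}:a\in A\}$. Let $\omega=-\frac12+i\frac{\sqrt3}{2}$. An $(n,k)$-frame is a Parseval frame $\{f_1,\dots,f_n\}$ for $\mathbb C^k$, i.e. $\sum_{j}|\langle x,f_j\rangle|^2=\|x\|^2$ for all $x\in\mathbb C^k$. It is equiangular if all $f_i\neq 0$ and there is a constant $b$ with $|\langle f_i/\|f_i\|,f_j/\|f_j\|\rangle|=b$ for all $i\ne j$. For $1\le k<n$, put $c_{n,k}=\sqrt{\frac{k(n-k)}{n^2(n-1)}}$. A self-adjoint $n\times n$ matrix $Q$ with $Q_{ii}=0$ and $|Q_{ij}|=1$ for $i\neq j$ is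 the signature matrix of an $(n,k)$-equiangular frame if there is an equiangular $(n,k)$-frame whose Gram matrix $(\langle f_j,f_i\rangle)_{i,j}$ equals $\frac kn I_n+c_{n,k}Q$. Throughout $1\le k<n$. The dimension $k$ is parametrized by a real number $\mu$ via $k=k(\mu)=\frac n2-\frac{\mu n}{2\sqrt{4(n-1)+\mu^2}}$, equivalently $\mu=(n-2k)\sqrt{\frac{n-1}{k(n-k)}}$. Let $\lambda$ be the left regular representation of $G$: $\lambda(g)e_h=e_{gh}$ on the vector space with basis $\{e_h\}_{h\in G}$, regarded as $n\times n$ permutation matrices. $(S,T)$ is a signature pair of sets for an $(n,k)$-cube root equiangular frame if $Q=\sum_{g\in S}\lambda(g)+\omega\sum_{g\in T}\lambda(g)+\omega^2\sum_{g\in V}\lambda(g)$ is the signature matrix of an $(n,k)$-equiangular frame. *)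

theory Defs
  imports "HOL-Algebra.Coset" "Jordan_Normal_Form.Schur_Decomposition"
begin

definition pair_count :: "('a, 'b) monoid_scheme \<Rightarrow> 'a set \<Rightarrow> 'a set \<Rightarrow> 'a \<Rightarrow> nat" where
  "pair_count G A B g = card {(g1, g2). g1 \<in> A \<and> g2 \<in> B \<and> g1 \<otimes>\<^bsub>G\<^esub> g2 = g}"

definition cube_root_unity :: complex where
  "cube_root_unity = Complex (- 1 / 2) (sqrt 3 / 2)"

(* The inner product x \<bullet>c y on complex vectors is linear in x and conjugate-linear in y. *)

definition cvec_norm :: "complex vec \<Rightarrow> real" where
  "cvec_norm x = sqrt (Re (x \<bullet>c x))"

(* An indexed family of n vectors is a function on nat of which only the values
   at 0, ..., n - 1 are used; repetitions are allowed. *)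

definition parseval_frame :: "nat \<Rightarrow> nat \<Rightarrow> (nat \<Rightarrow> complex vec) \<Rightarrow> bool" where
  "parseval_frame n k f \<longleftrightarrow>
     (\<forall>j<n. f j \<in> carrier_vec k) \<and>
     (\<forall>x\<in>carrier_vec k. (\<Sum>j<n. (cmod (x \<bullet>c f j))\<^sup>2) = (cvec_norm x)\<^sup>2)"

definition cvec_normalize :: "complex vec \<Rightarrow> complex vec" where
  "cvec_normalize x = complex_of_real (1 / cvec_norm x) \<cdot>\<^sub>v x"

definition equiangular_frame :: "nat \<Rightarrow> nat \<Rightarrow> (nat \<Rightarrow> complex vec) \<Rightarrow> bool" where
  "equiangular_frame n k f \<longleftrightarrow>
     parseval_frame n k f \<and>
     (\<forall>i<n. f i \<noteq> 0\<^sub>v k) \<and>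
     (\<exists>b::real. \<forall>i<n. \<forall>j<n. i \<noteq> j \<longrightarrow>
        cmod (cvec_normalize (f i) \<bullet>c cvec_normalize (f j)) = b)"

definition gram_matrix :: "nat \<Rightarrow> (nat \<Rightarrow> complex vec) \<Rightarrow> complex mat" where
  "gram_matrix n f = mat n n (\<lambda>(i, j). f j \<bullet>c f i)"

definition frame_const :: "nat \<Rightarrow> nat \<Rightarrow> real" where
  "frame_const n k = sqrt (real k * (real n - real k) / ((real n)\<^sup>2 * (real n - 1)))"

definition signature_matrix :: "nat \<Rightarrow> nat \<Rightarrow> complex mat \<Rightarrow> bool" where
  "signature_matrix n k Q \<longleftrightarrow>
     Q \<in> carrier_mat n n \<and>
     mat_adjoint Q = Q \<and>
     (\<forall>i<n. Q $$ (i, i) = 0) \<and>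
     (\<forall>i<n. \<forall>j<n. i \<noteq> j \<longrightarrow> cmod (Q $$ (i, j)) = 1) \<and>
     (\<exists>f. equiangular_frame n k f \<and>
        gram_matrix n f =
          complex_of_real (real k / real n) \<cdot>\<^sub>m 1\<^sub>m n + complex_of_real (frame_const n k) \<cdot>\<^sub>m Q)"

definition dim_of_mu :: "nat \<Rightarrow> real \<Rightarrow> real" where
  "dim_of_mu n \<mu> = real n / 2 - \<mu> * real n / (2 * sqrt (4 * (real n - 1) + \<mu>\<^sup>2))"

(* Matrices are indexed by 0, ..., n - 1, so group elements are numbered by a
   bijection el from {0..<n} onto the carrier; the basis vector e_h with h = el j
   becomes unit_vec n j. *)

definition left_regular ::
    "('a, 'b) monoid_scheme \<Rightarrow> nat \<Rightarrow> (nat \<Rightarrow> 'a) \<Rightarrow> 'a \<Rightarrow> complex mat" where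
  "left_regular G n el g = mat n n (\<lambda>(i, j). if el i = g \<otimes>\<^bsub>G\<^esub> el j then 1 else 0)"

lemma left_regular_mult_unit_vec:
  assumes "bij_betw el {0..<n} (carrier G)" "i < n" "j < n" "el i = g \<otimes>\<^bsub>G\<^esub> el j"
  shows "left_regular G n el g *\<^sub>v unit_vec n j = unit_vec n i"
proof (rule eq_vecI)
  fix l assume "l < dim_vec (unit_vec n i :: complex vec)"
  then have l: "l < n" by simp
  have "el l = el i \<longleftrightarrow> l = i"
    using assms(1,2) l by (auto simp: bij_betw_def inj_on_def)
  then show "(left_regular G n el g *\<^sub>v unit_vec n j) $ l = unit_vec n i $ l"
    using assms l by (simp add: left_regular_def)
qed (simp add: left_regular_def)

(* mat has no additive monoid instance (there is no dimension-free zero matrix),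
   so finite sums of n x n matrices are taken entrywise. *)

definition mat_setsum :: "nat \<Rightarrow> ('a \<Rightarrow> complex mat) \<Rightarrow> 'a set \<Rightarrow> complex mat" where
  "mat_setsum n F A = mat n n (\<lambda>ij. \<Sum>g\<in>A. F g $$ ij)"

definition signature_pair ::
    "('a, 'b) monoid_scheme \<Rightarrow> (nat \<Rightarrow> 'a) \<Rightarrow> nat \<Rightarrow> nat \<Rightarrow> 'a set \<Rightarrow> 'a set \<Rightarrow> bool" where
  "signature_pair G el n k S T \<longleftrightarrow>
     (let V = (carrier G - {\<one>\<^bsub>G\<^esub>}) - (S \<union> T) in
      signature_matrix n k
        (mat_setsum n (left_regular G n el) S
         + cube_root_unity \<cdot>\<^sub>m mat_setsum n (left_regular G n el) T
         + cube_root_unity\<^sup>2 \<cdot>\<^sub>m mat_setsum n (left_regular G n el) V))"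

end

theory Submission
  imports Defs "HOL-Library.Indicator_Function"
begin

text \<open>
  For a Parseval frame the Gram matrix \<open>P = k/n I + c Q\<close> is idempotent. Comparing coefficients
  in \<open>P\<^sup>2 = P\<close> shows that \<open>Q\<^sup>2\<close> agrees with a multiple of \<open>Q\<close> off the diagonal, and \<open>\<mu>\<close> is
  exactly this multiple (\<open>signature_matrix_square_off_diagonal\<close>).

  Let \<open>\<omega>\<close> be the primitive cube root of unity and \<open>w\<close> the function with values
  \<open>1\<close>, \<open>\<omega>\<close>, \<open>\<omega>\<^sup>2\<close>, \<open>0\<close> on \<open>S\<close>, \<open>T\<close>, \<open>V\<close>, \<open>{\<one>}\<close>. The matrix \<open>Q\<close> acts as left multiplication by
  \<open>w\<close> in the group algebra, so its quadratic equation says that the convolution \<open>w * w\<close> equals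
  \<open>\<mu> w\<close> away from \<open>\<one>\<close> (\<open>signature_pair_convolution\<close>). Writing \<open>A B\<close> for the number of factorizations
  of a fixed \<open>g\<close> with first factor in \<open>A\<close> and second factor in \<open>B\<close>, this convolution is
  \<open>(SS + TV + VT) + \<omega> (VV + ST + TS) + \<omega>\<^sup>2 (TT + SV + VS)\<close>. All counts and \<open>\<mu>\<close> are real, and
  \<open>1\<close>, \<open>\<omega>\<close>, \<open>\<omega>\<^sup>2\<close> satisfy only the real linear relation \<open>1 + \<omega> + \<omega>\<^sup>2 = 0\<close>; hence the three brackets
  become equal once \<open>\<mu>\<close> is subtracted from the one that belongs to the block of \<open>g\<close>
  (\<open>signature_pair_pair_count\<close>).

  On the other hand each factor of \<open>g\<close> determines the other one, so fixing the block of one factor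
  and letting the other one run through \<open>S\<close>, \<open>T\<close>, \<open>V\<close> counts the elements of a block, with \<open>g\<close>
  itself left out because its cofactor is \<open>\<one>\<close> (\<open>pair_count_blocks\<close>). Inversion maps \<open>T\<close> onto \<open>V\<close>,
  so these two blocks have the same size. The three identities are linear consequences of these
  row and column sums and of the two equations between the brackets. For instance, for
  \<open>g \<in> S\<close> the row and column sums give \<open>(ST + TS) - (SV + VS) = 2 (VV - TT)\<close>, while equality of the
  last two brackets gives \<open>(ST + TS) - (SV + VS) = TT - VV\<close>; so \<open>TT = VV\<close>, and \<open>ST + TS + TT\<close> is the
  second bracket. The brackets add up to \<open>n - 2\<close>, and the first one exceeds the other two by \<open>\<mu>\<close>, so
  the second one is \<open>(n - 2 - \<mu>) / 3\<close>. For \<open>g \<in> T\<close> the second bracket exceeds the first one by \<open>\<mu>\<close>,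
  and substituting the row sums of \<open>S\<close> and \<open>V\<close> and the column sum of \<open>V\<close> for \<open>n - 1 = |S| + 2 |V|\<close>
  turns \<open>\<mu> + n - 1\<close> into \<open>3 VV + 2 ST + 2 SV + TS + VS\<close>, where \<open>TS + VS = ST + SV\<close>. The case
  \<open>g \<in> V\<close> is symmetric.
\<close>

section \<open>The Gram matrix of a Parseval frame is idempotent\<close>

text \<open>
  Polarization over the complex numbers: the values \<open>c = 1\<close> and \<open>c = \<i>\<close> isolate the sum and the
  difference of \<open>h x y\<close> and \<open>h y x\<close>. Sesquilinearity enters only through the expansion of
  \<open>h (x + c y) (x + c y)\<close>.
\<close>

lemma sesquilinear_diag_zero_imp_zero:
  fixes h :: "complex vec \<Rightarrow> complex vec \<Rightarrow> complex"
  assumes x: "x \<in> carrier_vec k" and y: "y \<in> carrier_vec k"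
    and diag: "\<And>z. z \<in> carrier_vec k \<Longrightarrow> h z z = 0"
    and expand: "\<And>c. h (x + c \<cdot>\<^sub>v y) (x + c \<cdot>\<^sub>v y)
                  = h x x + cnj c * h x y + c * h y x + c * cnj c * h y y"
  shows "h x y = 0"
proof -
  have eq: "cnj c * h x y + c * h y x = 0" for c
    using expand[of c] diag[OF x] diag[OF y] diag[of "x + c \<cdot>\<^sub>v y"] x y by simp
  have "h x y + h y x = 0" using eq[of 1] by simp
  moreover have "h y x - h x y = 0"
  proof -
    have "\<i> * (h y x - h x y) = 0" using eq[of \<i>] by (simp add: algebra_simps)
    then show ?thesis by simp
  qed
  ultimately have "2 * h x y = 0" by (simp add: algebra_simps)
  then show ?thesis by simp
qed

lemma cscalar_prod_self_real: "complex_of_real ((cvec_norm x)\<^sup>2) = x \<bullet>c x"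
proof -
  have "x \<bullet>c x \<ge> 0" by (rule conjugate_square_ge_0_vec)
  then have "Re (x \<bullet>c x) \<ge> 0" "Im (x \<bullet>c x) = 0" by (auto simp: less_eq_complex_def)
  then show ?thesis by (simp add: cvec_norm_def complex_eq_iff)
qed

lemma cscalar_prod_add_smult_left:
  assumes "x \<in> carrier_vec k" "y \<in> carrier_vec k" "z \<in> carrier_vec k"
  shows "(x + c \<cdot>\<^sub>v y) \<bullet>c z = x \<bullet>c z + c * (y \<bullet>c (z :: complex vec))"
  using assms by (simp add: add_scalar_prod_distrib[where n = k] smult_scalar_prod_distrib[where n = k])

lemma cnj_cscalar_prod:
  assumes "x \<in> carrier_vec k" "y \<in> carrier_vec k"
  shows "cnj (x \<bullet>c y) = y \<bullet>c (x :: complex vec)"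
  using assms by (auto simp: scalar_prod_def intro!: sum.cong)

lemma cscalar_prod_add_smult_right:
  assumes "x \<in> carrier_vec k" "y \<in> carrier_vec k" "z \<in> carrier_vec k"
  shows "z \<bullet>c (x + c \<cdot>\<^sub>v y) = z \<bullet>c x + cnj c * (z \<bullet>c (y :: complex vec))"
proof -
  have "z \<bullet>c (x + c \<cdot>\<^sub>v y) = cnj ((x + c \<cdot>\<^sub>v y) \<bullet>c z)"
    using assms by (subst cnj_cscalar_prod[where k = k]) auto
  also have "\<dots> = cnj (x \<bullet>c z) + cnj c * cnj (y \<bullet>c z)"
    using assms by (simp add: cscalar_prod_add_smult_left[where k = k])
  finally show ?thesis
    using assms by (simp add: cnj_cscalar_prod[where k = k])
qed

text \<open>
  The Parseval condition equates the diagonals of two sesquilinear forms, so polarization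
  makes the forms equal. For \<open>x\<close> and \<open>y\<close> among the frame vectors this says that the Gram matrix is
  idempotent.
\<close>

lemma parseval_frame_inner_product:
  assumes "parseval_frame n k f" and x: "x \<in> carrier_vec k" and y: "y \<in> carrier_vec k"
  shows "(\<Sum>j<n. (x \<bullet>c f j) * (f j \<bullet>c y)) = x \<bullet>c y"
proof -
  define h where "h = (\<lambda>u v. (\<Sum>j<n. (u \<bullet>c f j) * cnj (v \<bullet>c f j)) - u \<bullet>c v)"
  have f: "f j \<in> carrier_vec k" if "j < n" for j
    using assms(1) that by (auto simp: parseval_frame_def)
  have diag: "h z z = 0" if z: "z \<in> carrier_vec k" for z
  proof -
    have "(\<Sum>j<n. (z \<bullet>c f j) * cnj (z \<bullet>c f j))
        = complex_of_real (\<Sum>j<n. (cmod (z \<bullet>c f j))\<^sup>2)"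
      unfolding of_real_sum by (intro sum.cong refl) (simp only: complex_norm_square)
    also have "\<dots> = complex_of_real ((cvec_norm z)\<^sup>2)"
      using assms(1) z by (simp only: parseval_frame_def)
    finally show ?thesis
      by (simp add: h_def cscalar_prod_self_real del: of_real_power)
  qed
  have "h x y = 0"
  proof (rule sesquilinear_diag_zero_imp_zero[where h = h, OF x y diag])
    fix c
    have "(\<Sum>j<n. ((x + c \<cdot>\<^sub>v y) \<bullet>c f j) * cnj ((x + c \<cdot>\<^sub>v y) \<bullet>c f j))
        = (\<Sum>j<n. (x \<bullet>c f j) * cnj (x \<bullet>c f j) + cnj c * ((x \<bullet>c f j) * cnj (y \<bullet>c f j))
            + c * ((y \<bullet>c f j) * cnj (x \<bullet>c f j)) + c * cnj c * ((y \<bullet>c f j) * cnj (y \<bullet>c f j)))"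
    proof (rule sum.cong)
      fix j assume "j \<in> {..<n}"
      then have e: "(x + c \<cdot>\<^sub>v y) \<bullet>c f j = x \<bullet>c f j + c * (y \<bullet>c f j)"
        using f x y by (simp add: cscalar_prod_add_smult_left[where k = k])
      show "((x + c \<cdot>\<^sub>v y) \<bullet>c f j) * cnj ((x + c \<cdot>\<^sub>v y) \<bullet>c f j)
        = (x \<bullet>c f j) * cnj (x \<bullet>c f j) + cnj c * ((x \<bullet>c f j) * cnj (y \<bullet>c f j))
            + c * ((y \<bullet>c f j) * cnj (x \<bullet>c f j)) + c * cnj c * ((y \<bullet>c f j) * cnj (y \<bullet>c f j))"
        unfolding e by (simp add: algebra_simps)
    qed simp
    moreover have "(x + c \<cdot>\<^sub>v y) \<bullet>c (x + c \<cdot>\<^sub>v y)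
        = x \<bullet>c x + cnj c * (x \<bullet>c y) + c * (y \<bullet>c x) + c * cnj c * (y \<bullet>c y)"
      using x y by (simp add: cscalar_prod_add_smult_left[where k = k]
          cscalar_prod_add_smult_right[where k = k] algebra_simps)
    ultimately show "h (x + c \<cdot>\<^sub>v y) (x + c \<cdot>\<^sub>v y)
        = h x x + cnj c * h x y + c * h y x + c * cnj c * h y y"
      unfolding h_def by (simp add: sum.distrib sum_distrib_left algebra_simps)
  qed
  then have "(\<Sum>j<n. (x \<bullet>c f j) * cnj (y \<bullet>c f j)) = x \<bullet>c y"
    by (simp add: h_def)
  moreover have "(\<Sum>j<n. (x \<bullet>c f j) * cnj (y \<bullet>c f j)) = (\<Sum>j<n. (x \<bullet>c f j) * (f j \<bullet>c y))"
    using f y by (intro sum.cong) (auto simp: cnj_cscalar_prod[where k = k])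
  ultimately show ?thesis by simp
qed

section \<open>The quadratic equation of a signature matrix\<close>

text \<open>
  The parametrization by \<open>\<mu>\<close> is chosen so that the frame constant becomes
  \<open>1 / sqrt (4 (n - 1) + \<mu>\<^sup>2)\<close>. Positivity is needed for cancelling this constant in the quadratic
  equation.
\<close>

lemma frame_const_dim_of_mu:
  assumes "1 \<le> k" "k < n" "real k = dim_of_mu n \<mu>"
  shows "frame_const n k > 0" and "real n - 2 * real k = \<mu> * real n * frame_const n k"
proof -
  define s where "s = sqrt (4 * (real n - 1) + \<mu>\<^sup>2)"
  have n: "real n - 1 > 0" using assms by simp
  have "4 * (real n - 1) + \<mu>\<^sup>2 > 0" using n by (simp add: add_pos_nonneg)
  then have s: "s > 0" and s2: "s\<^sup>2 = 4 * (real n - 1) + \<mu>\<^sup>2" by (simp_all add: s_def)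
  have k: "real k = real n / 2 - \<mu> * real n / (2 * s)"
    using assms(3) by (simp add: dim_of_mu_def s_def)
  have "real k * (real n - real k) = (real n)\<^sup>2 * (s\<^sup>2 - \<mu>\<^sup>2) / (4 * s\<^sup>2)"
    unfolding k using s by (simp add: field_simps power2_eq_square)
  also have "\<dots> = (1 / s)\<^sup>2 * ((real n)\<^sup>2 * (real n - 1))"
  proof -
    have "s\<^sup>2 - \<mu>\<^sup>2 = 4 * (real n - 1)" using s2 by simp
    then show ?thesis using s by (simp only:) (simp add: field_simps)
  qed
  finally have "real k * (real n - real k) / ((real n)\<^sup>2 * (real n - 1)) = (1 / s)\<^sup>2"
    using n by simp
  then have c: "frame_const n k = 1 / s"
    unfolding frame_const_def using s by (simp only: real_sqrt_abs) simp
  show "frame_const n k > 0" using s c by simp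
  show "real n - 2 * real k = \<mu> * real n * frame_const n k"
    unfolding c k using s by (simp add: field_simps)
qed

text \<open>
  Off the diagonal, \<open>P\<^sup>2 = P\<close> for \<open>P = r I + c Q\<close> reads \<open>2 r c Q + c\<^sup>2 Q\<^sup>2 = c Q\<close>, so
  \<open>c Q\<^sup>2 = (1 - 2 r) Q\<close>; and \<open>1 - 2 r = c \<mu>\<close> with \<open>r = k/n\<close>.
\<close>

lemma signature_matrix_square_off_diagonal:
  assumes sig: "signature_matrix n k Q" and "1 \<le> k" "k < n" "real k = dim_of_mu n \<mu>"
    and a: "a < n" and b: "b < n" and "a \<noteq> b"
  shows "(\<Sum>j<n. Q $$ (a, j) * Q $$ (j, b)) = complex_of_real \<mu> * Q $$ (a, b)"
proof -
  define c where "c = complex_of_real (frame_const n k)"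
  define r where "r = complex_of_real (real k / real n)"
  obtain f where f: "parseval_frame n k f"
    and gram: "gram_matrix n f = r \<cdot>\<^sub>m 1\<^sub>m n + c \<cdot>\<^sub>m Q"
    using sig by (auto simp: signature_matrix_def equiangular_frame_def c_def r_def)
  have Q: "Q \<in> carrier_mat n n" using sig by (simp add: signature_matrix_def)
  have fc: "f j \<in> carrier_vec k" if "j < n" for j
    using f that by (auto simp: parseval_frame_def)
  have G: "f j \<bullet>c f i = (if i = j then r else 0) + c * Q $$ (i, j)"
    if "i < n" "j < n" for i j
  proof -
    have "f j \<bullet>c f i = gram_matrix n f $$ (i, j)" using that by (simp add: gram_matrix_def)
    then show ?thesis unfolding gram using that Q by auto
  qed
  have "c * Q $$ (a, b) = f b \<bullet>c f a" using G a b \<open>a \<noteq> b\<close> by simp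
  also have "\<dots> = (\<Sum>j<n. (f b \<bullet>c f j) * (f j \<bullet>c f a))"
    using parseval_frame_inner_product[OF f fc[OF b] fc[OF a]] by simp
  also have "\<dots> = (\<Sum>j<n. (if j = b then r * (if a = b then r else 0) + r * c * Q $$ (a, b) else 0)
      + (if j = a then r * c * Q $$ (a, b) else 0) + c\<^sup>2 * (Q $$ (a, j) * Q $$ (j, b)))"
    using a b by (intro sum.cong) (auto simp: G algebra_simps power2_eq_square)
  also have "\<dots> = 2 * r * c * Q $$ (a, b) + c\<^sup>2 * (\<Sum>j<n. Q $$ (a, j) * Q $$ (j, b))"
    using a b \<open>a \<noteq> b\<close> by (simp add: sum.distrib sum_distrib_left)
  finally have "c * (c * (\<Sum>j<n. Q $$ (a, j) * Q $$ (j, b))) = c * ((1 - 2 * r) * Q $$ (a, b))"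
    by (simp add: algebra_simps power2_eq_square)
  moreover have "1 - 2 * r = c * complex_of_real \<mu>"
  proof -
    have "1 - 2 * (real k / real n) = frame_const n k * \<mu>"
      using frame_const_dim_of_mu(2)[OF assms(2-4)] \<open>k < n\<close> by (simp add: field_simps)
    then have "complex_of_real (1 - 2 * (real k / real n)) = complex_of_real (frame_const n k * \<mu>)"
      by (rule arg_cong)
    then show ?thesis by (simp add: c_def r_def)
  qed
  moreover have "c \<noteq> 0" using frame_const_dim_of_mu(1)[OF assms(2-4)] by (simp add: c_def)
  ultimately show ?thesis by simp
qed

section \<open>Counting factorizations in a finite group\<close>

context group
begin

lemma pair_count_left:
  assumes "A \<subseteq> carrier G" "B \<subseteq> carrier G" "g \<in> carrier G"
  shows "pair_count G A B g = card {a \<in> A. inv a \<otimes> g \<in> B}"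
proof -
  have "{(a, b). a \<in> A \<and> b \<in> B \<and> a \<otimes> b = g}
      = (\<lambda>a. (a, inv a \<otimes> g)) ` {a \<in> A. inv a \<otimes> g \<in> B}"
  proof (intro equalityI subsetI)
    fix p assume "p \<in> {(a, b). a \<in> A \<and> b \<in> B \<and> a \<otimes> b = g}"
    then obtain a b where p: "p = (a, b)" "a \<in> A" "b \<in> B" "a \<otimes> b = g" by auto
    then have "inv a \<otimes> g = b" using assms by (auto simp: m_assoc[symmetric] subset_iff)
    then show "p \<in> (\<lambda>a. (a, inv a \<otimes> g)) ` {a \<in> A. inv a \<otimes> g \<in> B}" using p by auto
  qed (use assms in \<open>auto simp: m_assoc[symmetric] subset_iff\<close>)
  then show ?thesis
    unfolding pair_count_def by (simp add: card_image inj_on_def)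
qed

lemma pair_count_right:
  assumes "A \<subseteq> carrier G" "B \<subseteq> carrier G" "g \<in> carrier G"
  shows "pair_count G A B g = card {b \<in> B. g \<otimes> inv b \<in> A}"
proof -
  have "{(a, b). a \<in> A \<and> b \<in> B \<and> a \<otimes> b = g}
      = (\<lambda>b. (g \<otimes> inv b, b)) ` {b \<in> B. g \<otimes> inv b \<in> A}"
  proof (intro equalityI subsetI)
    fix p assume "p \<in> {(a, b). a \<in> A \<and> b \<in> B \<and> a \<otimes> b = g}"
    then obtain a b where p: "p = (a, b)" "a \<in> A" "b \<in> B" "a \<otimes> b = g" by auto
    then have "g \<otimes> inv b = a" using assms by (auto simp: m_assoc subset_iff)
    then show "p \<in> (\<lambda>b. (g \<otimes> inv b, b)) ` {b \<in> B. g \<otimes> inv b \<in> A}" using p by auto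
  qed (use assms in \<open>auto simp: m_assoc subset_iff\<close>)
  then show ?thesis
    unfolding pair_count_def by (simp add: card_image inj_on_def)
qed

lemma pair_count_eq_convolution:
  assumes "finite (carrier G)" "A \<subseteq> carrier G" "B \<subseteq> carrier G" "g \<in> carrier G"
  shows "(\<Sum>b\<in>carrier G. indicator A (g \<otimes> inv b) * indicator B b)
           = (of_nat (pair_count G A B g) :: 'c :: semiring_1)"
proof -
  have "(\<Sum>b\<in>carrier G. indicator A (g \<otimes> inv b) * indicator B b :: 'c)
      = (\<Sum>b\<in>carrier G. if b \<in> {b \<in> B. g \<otimes> inv b \<in> A} then 1 else 0)"
    by (intro sum.cong) (auto simp: indicator_def)
  also have "\<dots> = of_nat (card (carrier G \<inter> {b \<in> B. g \<otimes> inv b \<in> A}))"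
    using assms(1) by (simp add: sum.If_cases)
  also have "carrier G \<inter> {b \<in> B. g \<otimes> inv b \<in> A} = {b \<in> B. g \<otimes> inv b \<in> A}"
    using assms(3) by auto
  finally show ?thesis using assms by (simp add: pair_count_right)
qed

lemma card_three_blocks:
  assumes "finite A" and "P \<inter> Q = {}" "P \<inter> R = {}" "Q \<inter> R = {}"
  shows "card {a \<in> A. f a \<in> P} + card {a \<in> A. f a \<in> Q} + card {a \<in> A. f a \<in> R}
           = card {a \<in> A. f a \<in> P \<union> Q \<union> R}"
proof -
  have "{a \<in> A. f a \<in> P \<union> Q \<union> R} = ({a \<in> A. f a \<in> P} \<union> {a \<in> A. f a \<in> Q}) \<union> {a \<in> A. f a \<in> R}"
    by auto
  then show ?thesis
    using assms by (simp only:) (subst card_Un_disjoint; (subst card_Un_disjoint)?; auto)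
qed

text \<open>
  Each \<open>a \<in> A\<close> has a unique cofactor in \<open>g\<close>, on either side. This cofactor lies in exactly one of
  the three blocks, except for \<open>a = g\<close>, where it is \<open>\<one>\<close>.
\<close>

lemma pair_count_blocks:
  assumes fin: "finite (carrier G)"
    and blocks: "S \<union> T \<union> V = carrier G - {\<one>}" "S \<inter> T = {}" "S \<inter> V = {}" "T \<inter> V = {}"
    and A: "A \<subseteq> carrier G" and g: "g \<in> carrier G"
  shows "pair_count G A S g + pair_count G A T g + pair_count G A V g = card (A - {g})"
    and "pair_count G S A g + pair_count G T A g + pair_count G V A g = card (A - {g})"
proof -
  have sub: "S \<subseteq> carrier G" "T \<subseteq> carrier G" "V \<subseteq> carrier G" using blocks(1) by auto
  have finA: "finite A" using A fin by (rule finite_subset)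
  have "inv a \<otimes> g = \<one> \<longleftrightarrow> a = g" "g \<otimes> inv a = \<one> \<longleftrightarrow> a = g" if "a \<in> A" for a
  proof -
    have a: "a \<in> carrier G" using that A by auto
    show "inv a \<otimes> g = \<one> \<longleftrightarrow> a = g"
      using a g by (metis inv_equality inv_inv inv_closed l_inv)
    show "g \<otimes> inv a = \<one> \<longleftrightarrow> a = g"
      using a g by (metis inv_equality inv_inv inv_closed r_inv)
  qed
  then have "{a \<in> A. inv a \<otimes> g \<in> S \<union> T \<union> V} = A - {g}" "{a \<in> A. g \<otimes> inv a \<in> S \<union> T \<union> V} = A - {g}"
    using A g unfolding blocks(1) by auto
  then show "pair_count G A S g + pair_count G A T g + pair_count G A V g = card (A - {g})"
    and "pair_count G S A g + pair_count G T A g + pair_count G V A g = card (A - {g})"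
    using card_three_blocks[OF finA blocks(2-4), of "\<lambda>a. inv a \<otimes> g"]
      card_three_blocks[OF finA blocks(2-4), of "\<lambda>a. g \<otimes> inv a"] A g sub
    by (simp_all only: pair_count_left[of A] pair_count_right[of _ A])
qed

end

section \<open>Linear relations over the cube roots of unity\<close>

lemma cube_root_unity_square: "cube_root_unity\<^sup>2 = - 1 - cube_root_unity"
  by (simp add: cube_root_unity_def power2_eq_square complex_eq_iff)

text \<open>
  Up to scaling, \<open>1 + \<omega> + \<omega>\<^sup>2 = 0\<close> is the only linear relation with real coefficients, since \<open>\<omega>\<close>
  is not real. This turns one complex equation into two real ones.
\<close>

lemma cube_root_unity_relation:
  assumes "of_real a + of_real b * cube_root_unity + of_real c * cube_root_unity\<^sup>2 = 0"
  shows "a = c" "b = c"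
proof -
  have "of_real (a - c) + of_real (b - c) * cube_root_unity = 0"
    using assms unfolding cube_root_unity_square by (simp add: algebra_simps)
  then have "(a - c) - (b - c) / 2 = 0" "(b - c) * (sqrt 3 / 2) = 0"
    by (simp_all add: cube_root_unity_def complex_eq_iff)
  then show "a = c" "b = c" by simp_all
qed

section \<open>The signature equation in the group algebra\<close>

definition signature_weight :: "'a set \<Rightarrow> 'a set \<Rightarrow> 'a set \<Rightarrow> 'a \<Rightarrow> complex" where
  "signature_weight S T V g = indicator S g + cube_root_unity * indicator T g
     + cube_root_unity\<^sup>2 * indicator V g"

context group
begin

text \<open>
  The only \<open>g\<close> for which \<open>\<lambda>(g)\<close> has a nonzero entry at position \<open>(i, j)\<close> is \<open>el i \<otimes> inv (el j)\<close>.
\<close>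

lemma mat_setsum_left_regular:
  assumes "finite (carrier G)" "bij_betw el {0..<n} (carrier G)" "A \<subseteq> carrier G" "i < n" "j < n"
  shows "mat_setsum n (left_regular G n el) A $$ (i, j) = indicator A (el i \<otimes> inv el j)"
proof -
  have el: "el i \<in> carrier G" "el j \<in> carrier G"
    using assms by (auto simp: bij_betw_def)
  have "mat_setsum n (left_regular G n el) A $$ (i, j)
      = (\<Sum>g\<in>A. if g = el i \<otimes> inv el j then 1 else 0)"
    unfolding mat_setsum_def left_regular_def using assms el
    by (auto intro!: sum.cong simp: subset_iff inv_solve_right)
  also have "\<dots> = indicator A (el i \<otimes> inv el j)"
    using finite_subset[OF assms(3,1)] by (simp add: indicator_def)
  finally show ?thesis .
qed

text \<open>
  An element of the group algebra is determined by the column at \<open>\<one>\<close> of its matrix. In this column,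
  at row \<open>g\<close>, the entry of \<open>Q\<close> is the weight of \<open>g\<close> and the entry of \<open>Q\<^sup>2\<close> is the convolution.
\<close>

lemma signature_pair_convolution:
  assumes fin: "finite (carrier G)"
    and el: "bij_betw el {0..<n} (carrier G)"
    and sub: "S \<subseteq> carrier G" "T \<subseteq> carrier G" and V: "V = (carrier G - {\<one>}) - (S \<union> T)"
    and k: "1 \<le> k" "k < n" "real k = dim_of_mu n \<mu>"
    and sig: "signature_pair G el n k S T"
    and g: "g \<in> carrier G" "g \<noteq> \<one>"
  shows "(\<Sum>b\<in>carrier G. signature_weight S T V (g \<otimes> inv b) * signature_weight S T V b)
           = complex_of_real \<mu> * signature_weight S T V g"
proof -
  define w where "w = signature_weight S T V"
  define Q where "Q = mat_setsum n (left_regular G n el) S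
         + cube_root_unity \<cdot>\<^sub>m mat_setsum n (left_regular G n el) T
         + cube_root_unity\<^sup>2 \<cdot>\<^sub>m mat_setsum n (left_regular G n el) V"
  have sigQ: "signature_matrix n k Q"
    using sig by (simp add: signature_pair_def Let_def Q_def V)
  have "V \<subseteq> carrier G" using V by auto
  then have Q: "Q $$ (i, j) = w (el i \<otimes> inv el j)" if "i < n" "j < n" for i j
    using that sub mat_setsum_left_regular[OF fin el _ that]
    by (simp add: Q_def w_def signature_weight_def mat_setsum_def)
  have img: "el ` {0..<n} = carrier G" using el by (simp add: bij_betw_def)
  obtain a where a: "a < n" "el a = g" using g(1) unfolding img[symmetric] by auto
  obtain e where e: "e < n" "el e = \<one>" using one_closed unfolding img[symmetric] by auto
  have "a \<noteq> e" using a e g by auto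
  have elc: "el j \<in> carrier G" if "j < n" for j using img that by auto
  have "(\<Sum>b\<in>carrier G. w (g \<otimes> inv b) * w b) = (\<Sum>j\<in>{0..<n}. w (g \<otimes> inv el j) * w (el j))"
    using sum.reindex_bij_betw[OF el, of "\<lambda>b. w (g \<otimes> inv b) * w b"] by simp
  also have "\<dots> = (\<Sum>j<n. Q $$ (a, j) * Q $$ (j, e))"
    using a e elc by (intro sum.cong) (auto simp: Q)
  also have "\<dots> = complex_of_real \<mu> * Q $$ (a, e)"
    using signature_matrix_square_off_diagonal[OF sigQ k a(1) e(1) \<open>a \<noteq> e\<close>] .
  also have "Q $$ (a, e) = w g" using a e g by (simp add: Q)
  finally show ?thesis by (simp add: w_def)
qed

text \<open>
  Expanding the convolution and grouping the nine products by powers of \<open>\<omega>\<close> modulo \<open>3\<close> yields the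
  three brackets; comparing them with \<open>\<mu>\<close> times the weight of \<open>g\<close> gives a real relation between
  \<open>1\<close>, \<open>\<omega>\<close> and \<open>\<omega>\<^sup>2\<close>.
\<close>

lemma signature_pair_pair_count:
  fixes S T V :: "'a set" and g :: 'a
  defines "N A B \<equiv> real (pair_count G A B g)"
  assumes fin: "finite (carrier G)"
    and el: "bij_betw el {0..<n} (carrier G)"
    and sub: "S \<subseteq> carrier G" "T \<subseteq> carrier G" and V: "V = (carrier G - {\<one>}) - (S \<union> T)"
    and k: "1 \<le> k" "k < n" "real k = dim_of_mu n \<mu>"
    and sig: "signature_pair G el n k S T"
    and g: "g \<in> carrier G" "g \<noteq> \<one>"
  shows "N S S + N T V + N V T - \<mu> * indicator S g = N T T + N S V + N V S - \<mu> * indicator V g"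
    and "N V V + N S T + N T S - \<mu> * indicator T g = N T T + N S V + N V S - \<mu> * indicator V g"
proof -
  let ?w = cube_root_unity
  have subV: "V \<subseteq> carrier G" using V by auto
  have "?w ^ 3 = ?w * ?w\<^sup>2" by (simp add: eval_nat_numeral)
  also have "\<dots> = ?w * (- 1 - ?w)" by (simp only: cube_root_unity_square)
  also have "\<dots> = - ?w - ?w\<^sup>2" by (simp add: algebra_simps power2_eq_square)
  also have "\<dots> = 1" unfolding cube_root_unity_square by simp
  finally have cube: "?w ^ 3 = 1" .
  define M :: "'a set \<Rightarrow> 'a set \<Rightarrow> complex"
    where "M A B = (\<Sum>b\<in>carrier G. indicator A (g \<otimes> inv b) * indicator B b)" for A B
  have M: "M A B = of_real (N A B)" if "A \<subseteq> carrier G" "B \<subseteq> carrier G" for A B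
    using pair_count_eq_convolution[OF fin that g(1), where 'c = complex] by (simp add: M_def N_def)
  have "of_real \<mu> * signature_weight S T V g
      = (\<Sum>b\<in>carrier G. signature_weight S T V (g \<otimes> inv b) * signature_weight S T V b)"
    using signature_pair_convolution[OF fin el sub V k sig g] by simp
  also have "\<dots> = M S S + ?w * M S T + ?w^2 * M S V + ?w * M T S + ?w^2 * M T T + ?w^3 * M T V
      + ?w^2 * M V S + ?w^3 * M V T + ?w^4 * M V V"
    unfolding M_def signature_weight_def sum_distrib_left sum.distrib[symmetric]
    by (intro sum.cong) (simp_all add: algebra_simps power2_eq_square power3_eq_cube power4_eq_xxxx)
  also have "?w ^ 4 = ?w" using cube by (simp add: eval_nat_numeral)
  finally have "of_real (N S S + N T V + N V T - \<mu> * indicator S g)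
      + of_real (N V V + N S T + N T S - \<mu> * indicator T g) * ?w
      + of_real (N T T + N S V + N V S - \<mu> * indicator V g) * ?w\<^sup>2 = 0"
    using sub subV cube
    by (simp add: M signature_weight_def algebra_simps of_real_indicator)
  from cube_root_unity_relation[OF this]
  show "N S S + N T V + N V T - \<mu> * indicator S g = N T T + N S V + N V S - \<mu> * indicator V g"
    and "N V V + N S T + N T S - \<mu> * indicator T g = N T T + N S V + N V S - \<mu> * indicator V g" .
qed

end

section \<open>The factorization identities of a signature pair\<close>

theorem theorem6p3:
  fixes G :: "('a, 'b) monoid_scheme" (structure)
    and el :: "nat \<Rightarrow> 'a" and S T V :: "'a set" and n k :: nat and \<mu> :: real
  assumes "group G"
    and "finite (carrier G)"
    and "card (carrier G) = n"
    and "bij_betw el {0..<n} (carrier G)"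
    and "S \<subseteq> carrier G - {\<one>}"
    and "T \<subseteq> carrier G - {\<one>}"
    and "S \<inter> T = {}"
    and "V = (carrier G - {\<one>}) - (S \<union> T)"
    and "S = set_inv S"
    and "set_inv T = V"
    and "1 \<le> k" and "k < n"
    and "real k = dim_of_mu n \<mu>"
    and "signature_pair G el n k S T"
  shows "(\<forall>g\<in>S. real (pair_count G S T g + pair_count G T S g + pair_count G T T g)
                   = (real n - 2 - \<mu>) / 3) \<and>
         (\<forall>h\<in>T. real (pair_count G V V h + pair_count G S T h + pair_count G S V h)
                   = (\<mu> + real n - 1) / 3) \<and>
         (\<forall>h'\<in>V. real (pair_count G T T h' + pair_count G S T h' + pair_count G S V h')
                   = (\<mu> + real n - 1) / 3)"
proof -
  interpret group G by fact
  note fin = assms(2) and el = assms(4) and V = assms(8)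
  have sub: "S \<subseteq> carrier G" "T \<subseteq> carrier G" "V \<subseteq> carrier G" using assms(5,6) V by auto
  have blocks: "S \<union> T \<union> V = carrier G - {\<one>}" "S \<inter> T = {}" "S \<inter> V = {}" "T \<inter> V = {}"
    using assms(5-7) V by auto
  have one: "\<one> \<notin> S" "\<one> \<notin> T" "\<one> \<notin> V" using assms(5,6) V by auto
  have finS: "finite S" "finite T" "finite V" using sub fin by (auto intro: finite_subset)
  have "V = (\<lambda>a. inv a) ` T" using assms(10) by (auto simp: SET_INV_def)
  moreover have "inj_on (\<lambda>a. inv a) T"
    using inj_on_subset[OF inv_inj sub(2)] by simp
  ultimately have VT: "card V = card T" by (simp add: card_image)
  have "insert \<one> (S \<union> T \<union> V) = carrier G"
    unfolding blocks(1) by auto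
  then have "n = card (insert \<one> (S \<union> T \<union> V))"
    using assms(3) by simp
  also have "\<dots> = 1 + card (S \<union> T \<union> V)"
    using finS one by simp
  also have "card (S \<union> T \<union> V) = card S + card T + card V"
    using finS blocks(2-4) by (simp add: card_Un_disjoint Int_Un_distrib2)
  finally have n: "real n = 1 + real (card S) + 2 * real (card T)" using VT by simp
  have card1: "real (card (A - {g})) = real (card A) - indicator A g" if "finite A" for A :: "'a set" and g
  proof (cases "g \<in> A")
    case True
    then have "card A \<ge> 1" using that by (simp add: Suc_le_eq card_gt_0_iff) blast
    then show ?thesis using True by (simp add: of_nat_diff)
  qed simp
  define N where "N A B g = real (pair_count G A B g)" for A B g
  have rows: "N A S g + N A T g + N A V g = real (card A) - indicator A g"
    and cols: "N S A g + N T A g + N V A g = real (card A) - indicator A g"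
    if "A \<subseteq> carrier G" "finite A" "g \<in> carrier G" for A g
    using pair_count_blocks[OF fin blocks that(1,3)] card1[OF that(2), of g]
    by (simp_all add: N_def flip: of_nat_add)
  \<comment> \<open>for fixed \<open>g\<close> everything below is linear arithmetic in the nine counts, \<open>card S\<close>, \<open>card T\<close> and \<open>\<mu>\<close>\<close>
  note lin = signature_pair_pair_count[OF fin el sub(1,2) V assms(11-14), folded N_def]
  note all = lin rows[OF sub(1) finS(1)] rows[OF sub(2) finS(2)] rows[OF sub(3) finS(3)]
    cols[OF sub(1) finS(1)] cols[OF sub(2) finS(2)] cols[OF sub(3) finS(3)]
  have S: "N S T g + N T S g + N T T g = (real n - 2 - \<mu>) / 3" if "g \<in> S" for g
  proof -
    have g: "g \<in> carrier G" "g \<noteq> \<one>" "g \<in> S" "g \<notin> T" "g \<notin> V" using that sub one blocks by auto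
    show ?thesis using all[of g] n VT g by simp
  qed
  have T: "N V V g + N S T g + N S V g = (\<mu> + real n - 1) / 3" if "g \<in> T" for g
  proof -
    have g: "g \<in> carrier G" "g \<noteq> \<one>" "g \<notin> S" "g \<in> T" "g \<notin> V" using that sub one blocks by auto
    show ?thesis using all[of g] n VT g by simp
  qed
  have V: "N T T g + N S T g + N S V g = (\<mu> + real n - 1) / 3" if "g \<in> V" for g
  proof -
    have g: "g \<in> carrier G" "g \<noteq> \<one>" "g \<notin> S" "g \<notin> T" "g \<in> V" using that sub one blocks by auto
    show ?thesis using all[of g] n VT g by simp
  qed
  show ?thesis using S T V by (simp add: N_def)
qed

end
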